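(* For every integer $N\ge2$, $$\frac{N^2}{\alpha_N B_{GN}}<N,$$ where $\alpha_N=N\omega_{N-1}^{1/(N-1)}$ and $B_{GN}$ is the best Gagliardo--Nirenberg constant defined in the context.
   Context: $N'=\frac{N}{N-1}$, and $\omega_{N-1}$ is the surface area of the unit ball in $\mathbb{R}^N$ (the $(N-1)$-dimensional measure of the unit sphere). The constant $B_{GN}$ is $$B_{GN}=\sup_{u\in W^{1,N}(\mathbb{R}^N)\setminus\{0\}}\frac{\|u\|_{L^{NN'}(\mathbb{R}^N)}^{NN'}}{\|u\|_{L^N(\mathbb{R}^N)}^{N}\,\|\nabla u\|_{L^N(\mathbb{R}^N)}^{NN'-N}}\in(0,\infty).$$ *)

theory Defs
  imports "HOL-Analysis.Analysis"
begin

definition epowr :: "ennreal \<Rightarrow> real \<Rightarrow> ennreal" where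
  \<comment> \<open>Intended for exponents \<open>a > 0\<close> only.\<close>
  "epowr x a = (if x = \<infinity> then \<infinity> else ennreal (enn2real x powr a))"

definition Lp_norm :: "real \<Rightarrow> ('a::euclidean_space \<Rightarrow> 'b::real_normed_vector) \<Rightarrow> ennreal" where
  "Lp_norm p f = epowr (\<integral>\<^sup>+ x. ennreal (norm (f x) powr p) \<partial>lebesgue) (1 / p)"

definition Lp_space :: "real \<Rightarrow> ('a::euclidean_space \<Rightarrow> 'b::real_normed_vector) set" where
  "Lp_space p = {f. f \<in> borel_measurable lebesgue \<and> Lp_norm p f < \<infinity>}"

definition locally_integrable :: "('a::euclidean_space \<Rightarrow> 'b::{banach, second_countable_topology}) \<Rightarrow> bool" where
  "locally_integrable f \<longleftrightarrow> (\<forall>K. compact K \<longrightarrow> set_integrable lebesgue K f)"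

definition partial_derivative ::
  "'a::euclidean_space \<Rightarrow> ('a \<Rightarrow> real) \<Rightarrow> 'a \<Rightarrow> real" where
  "partial_derivative b f = (\<lambda>x. frechet_derivative f (at x) b)"

fun C_k :: "nat \<Rightarrow> ('a::euclidean_space \<Rightarrow> real) \<Rightarrow> bool" where
  "C_k 0 f \<longleftrightarrow> continuous_on UNIV f"
| "C_k (Suc k) f \<longleftrightarrow>
     f differentiable_on UNIV \<and> (\<forall>b\<in>Basis. C_k k (partial_derivative b f))"

definition test_function :: "('a::euclidean_space \<Rightarrow> real) \<Rightarrow> bool" where
  "test_function \<phi> \<longleftrightarrow> (\<forall>k. C_k k \<phi>) \<and> compact (closure {x. \<phi> x \<noteq> 0})"

definition has_weak_gradient :: "('a::euclidean_space \<Rightarrow> real) \<Rightarrow> ('a \<Rightarrow> 'a) \<Rightarrow> bool" where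
  "has_weak_gradient u g \<longleftrightarrow> locally_integrable u \<and> locally_integrable g \<and>
     (\<forall>\<phi>. test_function \<phi> \<longrightarrow> (\<forall>b\<in>Basis.
        (\<integral>x. u x * partial_derivative b \<phi> x \<partial>lebesgue) = - (\<integral>x. (g x \<bullet> b) * \<phi> x \<partial>lebesgue)))"

definition W1p :: "real \<Rightarrow> ('a::euclidean_space \<Rightarrow> real) set" where
  "W1p p = {u \<in> Lp_space p. \<exists>g \<in> Lp_space p. has_weak_gradient u g}"

text \<open>
  The supremum is taken in \<open>[0, \<infinity>]\<close>. Functions are not identified almost everywhere, so
  \<open>u \<noteq> 0\<close> reads as: \<open>u\<close> does not vanish almost everywhere. The weak gradient is unique
  up to a null set, so the quotient does not depend on the choice of \<open>g\<close>.
\<close>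

definition B_GN :: "'a::euclidean_space itself \<Rightarrow> ennreal" where
  "B_GN _ =
    (let N = real DIM('a); N' = N / (N - 1) in
     Sup {epowr (Lp_norm (N * N') u) (N * N') /
            (epowr (Lp_norm N u) N * epowr (Lp_norm N g) (N * N' - N)) | (u :: 'a \<Rightarrow> real) g.
          u \<in> W1p N \<and> \<not> (AE x in lebesgue. u x = 0) \<and> has_weak_gradient u g})"

text \<open>
  Surface measure on the unit sphere, in its usual normalisation by polar coordinates: the
  measure of \<open>A\<close> is the dimension times the volume of the cone over \<open>A\<close> with apex \<open>0\<close>.
\<close>

definition sphere_measure :: "'a::euclidean_space set \<Rightarrow> real" where
  "sphere_measure A =
     real DIM('a) * measure lebesgue {r *\<^sub>R x | r x. 0 < r \<and> r \<le> 1 \<and> x \<in> A}"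

definition unit_sphere_area :: "'a::euclidean_space itself \<Rightarrow> real" where
  "unit_sphere_area _ = sphere_measure (sphere 0 1 :: 'a set)"

definition alpha :: "'a::euclidean_space itself \<Rightarrow> real" where
  "alpha T = real DIM('a) * unit_sphere_area T powr (1 / (real DIM('a) - 1))"

end

(*
  Any admissible u gives a lower bound for B_GN, and for radial u = f(|x|) the volume V of the unit
  ball drops out: the claim alpha * B_GN > N reduces to an inequality between one-dimensional
  integrals of f and f'.  For N >= 3 the function exp(-|x|) is good enough: all integrals are
  V * N! / p^N, and the inequality becomes (N-1)!/N^N < ((N-1)/N)^(N(N-1)), an induction based on
  Bernoulli's inequality.  For N = 2 both exp(-|x|) and the Gaussian give equality only, and
  2 exp(-|x|) - exp(-2|x|) is used instead.

  Since exp(-|x|) is Lipschitz but not differentiable at 0, the weak gradient needs an argument: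
  integration by parts against a test function is the statement that a compactly supported Lipschitz function has
  derivative of integral zero, which follows from translation invariance of the integral by
  dominated convergence of difference quotients.
*)
theory Submission
  imports Defs "HOL-Probability.Distributions" "HOL-Real_Asymp.Real_Asymp"
begin

section \<open>Integration by parts and weak gradients of Lipschitz functions\<close>

lemma integrable_lborel_bounded_support:
  fixes f :: "'a::euclidean_space \<Rightarrow> real"
  assumes [measurable]: "f \<in> borel_measurable borel"
    and K: "compact K" and bound: "\<And>x. \<bar>f x\<bar> \<le> C" and zero: "\<And>x. x \<notin> K \<Longrightarrow> f x = 0"
  shows "integrable lborel f"
proof (rule Bochner_Integration.integrable_bound[where f = "\<lambda>x. indicator K x * C"])
  have "emeasure lborel K < \<infinity>"
    using K emeasure_compact_finite by blast
  then show "integrable lborel (\<lambda>x. indicator K x * C)"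
    using K by (intro integrable_mult_left integrable_real_indicator) (auto simp: borel_compact)
  show "AE x in lborel. norm (f x) \<le> norm (indicator K x * C)"
    using zero by (intro AE_I2) (auto simp: indicator_def intro: order_trans[OF bound abs_ge_self])
qed simp

text \<open>Applied to a product \<open>u x * \<phi> x\<close>, this is integration by parts. Asking
  for the derivative only almost everywhere admits radial functions with a corner at the
  origin.\<close>

lemma integral_lipschitz_derivative_eq_0:
  fixes h :: "'a::euclidean_space \<Rightarrow> real"
  assumes lip: "L-lipschitz_on UNIV h"
    and K: "compact K" and zero: "\<And>x. x \<notin> K \<Longrightarrow> h x = 0"
    and deriv: "AE x in lborel. (h has_derivative D x) (at x)"
    and [measurable]: "(\<lambda>x. D x b) \<in> borel_measurable borel"
  shows "(\<integral>x. D x b \<partial>lborel) = 0"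
proof -
  let ?t = "\<lambda>n. 1 / real (Suc n)"
  define s where "s n x = (h (x + ?t n *\<^sub>R b) - h x) / ?t n" for n x
  have conth: "continuous_on UNIV h"
    using lip lipschitz_on_continuous_on by blast
  then have [measurable]: "h \<in> borel_measurable borel"
    by (rule borel_measurable_continuous_onI)
  obtain r where r: "K \<subseteq> cball 0 r"
    using compact_imp_bounded[OF K] by (auto simp: bounded_iff subset_iff)
  have hint: "integrable lborel h"
  proof -
    have "bounded (h ` K)"
      using K conth by (intro compact_imp_bounded compact_continuous_image continuous_on_subset[OF conth]) auto
    then obtain C where C: "\<And>x. x \<in> K \<Longrightarrow> \<bar>h x\<bar> \<le> C"
      by (auto simp: bounded_iff)
    have "\<bar>h x\<bar> \<le> max C 0" for x
      using C[of x] zero[of x] by (cases "x \<in> K") auto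
    then show ?thesis
      by (intro integrable_lborel_bounded_support[OF _ K _ zero]) simp_all
  qed
  have shift: "integrable lborel (\<lambda>x. h (x + c))" "(\<integral>x. h (x + c) \<partial>lborel) = (\<integral>x. h x \<partial>lborel)" for c
  proof -
    have eq: "lborel = distr lborel borel ((+) c)"
      by (rule lborel_distr_plus[symmetric])
    have "integrable (distr lborel borel ((+) c)) h"
      using hint by (subst lborel_distr_plus)
    then show "integrable lborel (\<lambda>x. h (x + c))"
      by (subst (asm) integrable_distr_eq) (auto simp: add.commute)
    show "(\<integral>x. h (x + c) \<partial>lborel) = (\<integral>x. h x \<partial>lborel)"
      by (subst (2) eq, subst integral_distr) (auto simp: add.commute)
  qed
  have s0: "(\<integral>x. s n x \<partial>lborel) = 0" for n
    unfolding s_def using shift hint by simp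
  have "(\<lambda>n. \<integral>x. s n x \<partial>lborel) \<longlonglongrightarrow> (\<integral>x. D x b \<partial>lborel)"
  \<comment> \<open>Because \<open>?t n\<close> is at most 1, every quotient vanishes where
    \<open>norm x\<close> exceeds \<open>r + norm b\<close>. On the remaining ball the Lipschitz
    constant bounds it by \<open>L * norm b\<close>, uniformly in n.\<close>
  proof (rule integral_dominated_convergence[where w = "\<lambda>x. indicator (cball 0 (r + norm b)) x * (L * norm b)"])
    show "s n \<in> borel_measurable lborel" for n
      unfolding s_def by measurable
    show "integrable lborel (\<lambda>x. indicator (cball 0 (r + norm b)) (x::'a) * (L * norm b))"
      using emeasure_compact_finite[OF compact_cball, of "0::'a"]
      by (intro integrable_mult_left integrable_real_indicator) auto
    show "AE x in lborel. (\<lambda>n. s n x) \<longlonglongrightarrow> D x b"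
      using deriv
    proof eventually_elim
      case (elim x)
      have lin: "linear (D x)" using elim has_derivative_linear by blast
      \<comment> \<open>Along the line x + t b the derivative becomes an ordinary one at t = 0, and
        \<open>s n x\<close> is its difference quotient with increment 1/(n+1).\<close>
      have "((\<lambda>t. x + t *\<^sub>R b) has_derivative (\<lambda>t. t *\<^sub>R b)) (at 0)"
        by (auto intro!: derivative_eq_intros)
      then have "((\<lambda>t. h (x + t *\<^sub>R b)) has_derivative (\<lambda>t. D x (t *\<^sub>R b))) (at 0)"
        using has_derivative_compose[of "\<lambda>t. x + t *\<^sub>R b" _ 0 UNIV h "D x"] elim by simp
      then have "((\<lambda>t. h (x + t *\<^sub>R b)) has_real_derivative D x b) (at 0)"
        by (simp add: has_field_derivative_def linear_cmul[OF lin] mult_commute_abs)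
      then have lim: "((\<lambda>t. (h (x + t *\<^sub>R b) - h x) / t) \<longlongrightarrow> D x b) (at 0)"
        by (simp add: DERIV_def)
      have "filterlim ?t (at 0) sequentially"
        unfolding filterlim_at using LIMSEQ_inverse_real_of_nat by (auto simp: inverse_eq_divide)
      from filterlim_compose[OF lim this] show ?case by (simp add: s_def)
    qed
    show "AE x in lborel. norm (s n x) \<le> indicator (cball 0 (r + norm b)) x * (L * norm b)" for n
    proof (rule AE_I2)
      fix x :: 'a
      have t: "0 < ?t n" "?t n \<le> 1" by auto
      have "\<bar>h (x + ?t n *\<^sub>R b) - h x\<bar> \<le> L * norm (?t n *\<^sub>R b)"
        using lipschitz_on_normD[OF lip, of "x + ?t n *\<^sub>R b" x] by simp
      also have "\<dots> = ?t n * (L * norm b)"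
        using t by simp
      finally have "\<bar>s n x\<bar> \<le> L * norm b"
        unfolding s_def abs_divide using t by (simp only: pos_divide_le_eq abs_of_pos mult.commute)
      moreover have "s n x = 0" if x: "x \<notin> cball 0 (r + norm b)"
      proof -
        have "norm (?t n *\<^sub>R b) \<le> norm b"
          using t by (simp add: mult_left_le_one_le divide_le_eq_1 field_simps mult_nonneg_nonneg)
        then have "x + ?t n *\<^sub>R b \<notin> cball 0 r"
          using x norm_triangle_ineq4[of "x + ?t n *\<^sub>R b" "?t n *\<^sub>R b"] by (auto simp del: norm_scaleR)
        moreover have "x \<notin> cball 0 r"
          using x norm_ge_zero[of b] by (auto simp del: norm_ge_zero)
        ultimately have "h (x + ?t n *\<^sub>R b) = 0" "h x = 0"
          using r zero by blast+
        then show ?thesis by (simp add: s_def)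
      qed
      ultimately show "norm (s n x) \<le> indicator (cball 0 (r + norm b)) x * (L * norm b)"
        by (auto simp: indicator_def)
    qed
  qed auto
  then show ?thesis
    using s0 LIMSEQ_unique[OF tendsto_const, of 0] by simp
qed

text \<open>Compact support turns continuity into boundedness, for \<phi> and for its partial
  derivatives. Bounded partials bound the operator norm of the derivative, which gives the Lipschitz
  property on the whole space.\<close>

lemma test_function_regularity:
  fixes \<phi> :: "'a::euclidean_space \<Rightarrow> real"
  assumes "test_function \<phi>"
  shows test_function_has_derivative: "(\<phi> has_derivative frechet_derivative \<phi> (at x)) (at x)"
    and test_function_continuous_partial: "b \<in> Basis \<Longrightarrow> continuous_on UNIV (partial_derivative b \<phi>)"
    and test_function_partial_zero: "x \<notin> closure {x. \<phi> x \<noteq> 0} \<Longrightarrow> partial_derivative b \<phi> x = 0"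
    and test_function_bounded: "\<exists>C. \<forall>x. \<bar>\<phi> x\<bar> \<le> C"
    and test_function_bounded_partial: "b \<in> Basis \<Longrightarrow> \<exists>C. \<forall>x. \<bar>partial_derivative b \<phi> x\<bar> \<le> C"
    and test_function_lipschitz: "\<exists>L. L-lipschitz_on UNIV \<phi>"
proof -
  define S where "S = closure {x. \<phi> x \<noteq> 0}"
  have S: "compact S" and C: "C_k (Suc (Suc 0)) \<phi>"
    using assms unfolding test_function_def S_def by blast+
  show der: "(\<phi> has_derivative frechet_derivative \<phi> (at x)) (at x)" for x
    using C by (simp add: differentiable_on_def frechet_derivative_works[symmetric])
  show cont: "continuous_on UNIV (partial_derivative b \<phi>)" if "b \<in> Basis" for b
    using C that by (auto intro: differentiable_imp_continuous_on)
  have \<phi>0: "\<phi> y = 0" if "y \<notin> S" for y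
    using that closure_subset[of "{x. \<phi> x \<noteq> 0}"] unfolding S_def by blast
  have zero: "partial_derivative b \<phi> x = 0" if x: "x \<notin> S" for b x
  proof -
    have "open (- S)"
      using S by (simp add: compact_imp_closed open_Compl)
    then have "(\<phi> has_derivative (\<lambda>_. 0)) (at x)"
      using x \<phi>0
      by (intro has_derivative_transform_within_open[OF has_derivative_const[of 0], where s = "- S"]) auto
    then show ?thesis
      using frechet_derivative_at[of \<phi> "\<lambda>_. 0" x]
      by (metis partial_derivative_def)
  qed
  then show "x \<notin> closure {x. \<phi> x \<noteq> 0} \<Longrightarrow> partial_derivative b \<phi> x = 0"
    unfolding S_def by blast
  have bnd: "\<exists>C. \<forall>x. \<bar>f x\<bar> \<le> C"
    if c: "continuous_on UNIV f" and z: "\<And>x. x \<notin> S \<Longrightarrow> f x = 0" for f :: "'a \<Rightarrow> real"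
  proof -
    have "bounded (f ` S)"
      by (intro compact_imp_bounded compact_continuous_image S continuous_on_subset[OF c]) auto
    then obtain C where C: "\<And>x. x \<in> S \<Longrightarrow> \<bar>f x\<bar> \<le> C"
      by (auto simp: bounded_iff)
    have "\<bar>f x\<bar> \<le> max C 0" for x
      using C[of x] z[of x] by (cases "x \<in> S") auto
    then show ?thesis by blast
  qed
  have "continuous_on UNIV \<phi>"
    using C by (auto intro: differentiable_imp_continuous_on)
  then show "\<exists>C. \<forall>x. \<bar>\<phi> x\<bar> \<le> C"
    using bnd \<phi>0 by blast
  show bp: "\<exists>C. \<forall>x. \<bar>partial_derivative b \<phi> x\<bar> \<le> C" if "b \<in> Basis" for b
    using bnd[OF cont[OF that] zero] by blast
  then obtain B where B: "\<And>b x. b \<in> Basis \<Longrightarrow> \<bar>partial_derivative b \<phi> x\<bar> \<le> B b"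
    by metis
  \<comment> \<open>Expanding a vector in the standard basis, each coordinate is at most its norm,
    so the sum of the coordinate bounds dominates the operator norm.\<close>
  define L where "L = (\<Sum>b\<in>Basis. B b)"
  have L: "0 \<le> L"
    unfolding L_def using B by (intro sum_nonneg) (meson abs_ge_zero order_trans)
  have "onorm (frechet_derivative \<phi> (at x)) \<le> L" for x
  proof (rule onorm_le)
    fix v :: 'a
    have lin: "linear (frechet_derivative \<phi> (at x))"
      using der has_derivative_linear by blast
    have "frechet_derivative \<phi> (at x) v
        = frechet_derivative \<phi> (at x) (\<Sum>b\<in>Basis. (v \<bullet> b) *\<^sub>R b)"
      by (simp add: euclidean_representation)
    also have "\<dots> = (\<Sum>b\<in>Basis. (v \<bullet> b) * partial_derivative b \<phi> x)"
      by (simp add: linear_sum[OF lin] linear_cmul[OF lin] partial_derivative_def)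
    also have "norm \<dots> \<le> (\<Sum>b\<in>Basis. norm v * B b)"
      using B by (intro sum_norm_le) (auto simp: abs_mult intro!: mult_mono Basis_le_norm)
    finally show "norm (frechet_derivative \<phi> (at x) v) \<le> L * norm v"
      by (simp add: L_def sum_distrib_left mult.commute)
  qed
  then have "L-lipschitz_on UNIV \<phi>"
    using der L by (intro bounded_derivative_imp_lipschitz[of UNIV \<phi> "\<lambda>x. frechet_derivative \<phi> (at x)"]) auto
  then show "\<exists>L. L-lipschitz_on UNIV \<phi>" ..
qed

lemma locally_integrable_bounded:
  fixes f :: "'a::euclidean_space \<Rightarrow> 'b::{banach, second_countable_topology}"
  assumes [measurable]: "f \<in> borel_measurable borel" and bound: "\<And>x. norm (f x) \<le> C"
  shows "locally_integrable f"
  unfolding locally_integrable_def set_integrable_def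
proof (intro allI impI)
  fix K :: "'a set" assume K: "compact K"
  then have [measurable]: "K \<in> sets borel" by (rule borel_compact)
  have "integrable lborel (\<lambda>x. indicator K x *\<^sub>R f x)"
  proof (rule Bochner_Integration.integrable_bound[where f = "\<lambda>x. indicator K x * C"])
    show "integrable lborel (\<lambda>x. indicator K x * C)"
      using emeasure_compact_finite[OF K]
      by (intro integrable_mult_left integrable_real_indicator) auto
    show "AE x in lborel. norm (indicator K x *\<^sub>R f x) \<le> norm (indicator K x * C)"
      by (intro AE_I2) (auto simp: indicator_def intro: order_trans[OF bound abs_ge_self])
  qed simp
  then show "integrable lebesgue (\<lambda>x. indicator K x *\<^sub>R f x)"
    by (subst integrable_completion) simp_all
qed

text \<open>The product of u with a test function is Lipschitz, has compact support and obeys the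
  product rule almost everywhere, so the integral of its derivative in a basis direction is zero.
  Splitting that integral gives the defining identity of the weak gradient.\<close>

lemma has_weak_gradient_lipschitz:
  fixes u :: "'a::euclidean_space \<Rightarrow> real"
  assumes lip: "L-lipschitz_on UNIV u" and M: "\<And>x. \<bar>u x\<bar> \<le> M"
    and [measurable]: "g \<in> borel_measurable borel" and B: "\<And>x. norm (g x) \<le> B"
    and deriv: "AE x in lborel. (u has_derivative (\<lambda>v. g x \<bullet> v)) (at x)"
  shows "has_weak_gradient u g"
proof -
  have [measurable]: "u \<in> borel_measurable borel"
    using lip by (intro borel_measurable_continuous_onI lipschitz_on_continuous_on)
  have "(\<integral>x. u x * partial_derivative b \<phi> x \<partial>lebesgue) = - (\<integral>x. (g x \<bullet> b) * \<phi> x \<partial>lebesgue)"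
    if \<phi>: "test_function \<phi>" and b: "b \<in> Basis" for \<phi> b
  proof -
    define S where "S = closure {x. \<phi> x \<noteq> 0}"
    let ?d = "partial_derivative b \<phi>"
    have S: "compact S" using \<phi> by (simp add: test_function_def S_def)
    have \<phi>0: "\<phi> x = 0" if "x \<notin> S" for x
      using that closure_subset[of "{x. \<phi> x \<noteq> 0}"] unfolding S_def by blast
    obtain C where C: "\<And>x. \<bar>\<phi> x\<bar> \<le> C" using test_function_bounded[OF \<phi>] by blast
    obtain E where E: "\<And>x. \<bar>?d x\<bar> \<le> E" using test_function_bounded_partial[OF \<phi> b] by blast
    obtain L' where L': "L'-lipschitz_on UNIV \<phi>" using test_function_lipschitz[OF \<phi>] by blast
    have nonneg: "0 \<le> C" "0 \<le> E" "0 \<le> B" "0 \<le> M" "0 \<le> L" "0 \<le> L'"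
      using C[of 0] E[of 0] B[of 0] M[of 0] norm_ge_zero[of "g 0"] lipschitz_on_nonneg[OF L'] lipschitz_on_nonneg[OF lip]
      by linarith+
    have [measurable]: "\<phi> \<in> borel_measurable borel"
      using L' by (intro borel_measurable_continuous_onI lipschitz_on_continuous_on)
    have [measurable]: "?d \<in> borel_measurable borel"
      using test_function_continuous_partial[OF \<phi> b] by (intro borel_measurable_continuous_onI)
    have gb: "\<bar>g x \<bullet> b\<bar> \<le> B" for x
      using Basis_le_norm[OF b, of "g x"] B[of x] by linarith
    have int1: "integrable lborel (\<lambda>x. u x * ?d x)"
      using test_function_partial_zero[OF \<phi>, folded S_def] M E nonneg
      by (intro integrable_lborel_bounded_support[OF _ S, where C = "M * E"])
         (auto simp: abs_mult intro!: mult_mono)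
    have int2: "integrable lborel (\<lambda>x. (g x \<bullet> b) * \<phi> x)"
      using \<phi>0 gb C nonneg
      by (intro integrable_lborel_bounded_support[OF _ S, where C = "B * C"])
         (auto simp: abs_mult intro!: mult_mono)
    have "(M * L' + C * L)-lipschitz_on UNIV (\<lambda>x. u x * \<phi> x)"
    proof (rule lipschitz_onI)
      fix x y
      have "\<bar>u x * \<phi> x - u y * \<phi> y\<bar> = \<bar>u x * (\<phi> x - \<phi> y) + \<phi> y * (u x - u y)\<bar>"
        by (simp add: algebra_simps)
      also have "\<dots> \<le> \<bar>u x\<bar> * \<bar>\<phi> x - \<phi> y\<bar> + \<bar>\<phi> y\<bar> * \<bar>u x - u y\<bar>"
        by (metis abs_mult abs_triangle_ineq)
      also have "\<dots> \<le> M * (L' * dist x y) + C * (L * dist x y)"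
        using M C lipschitz_onD[OF lip, of x y] lipschitz_onD[OF L', of x y] nonneg
        by (intro add_mono mult_mono) (auto simp: dist_real_def)
      finally show "dist (u x * \<phi> x) (u y * \<phi> y) \<le> (M * L' + C * L) * dist x y"
        by (simp add: dist_real_def algebra_simps)
    qed (use nonneg in auto)
    moreover have "AE x in lborel. ((\<lambda>x. u x * \<phi> x) has_derivative
        (\<lambda>v. u x * frechet_derivative \<phi> (at x) v + (g x \<bullet> v) * \<phi> x)) (at x)"
      using deriv
      by eventually_elim (rule has_derivative_mult[OF _ test_function_has_derivative[OF \<phi>]])
    \<comment> \<open>In the direction b the derivative of \<phi> is
      \<open>partial_derivative b \<phi>\<close>; folding this definition exposes a term already
      known to be measurable.\<close>
    moreover have "(\<lambda>x. u x * frechet_derivative \<phi> (at x) b + (g x \<bullet> b) * \<phi> x) \<in> borel_measurable borel"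
      unfolding partial_derivative_def[of b \<phi>, THEN fun_cong, symmetric] by measurable
    ultimately have "(\<integral>x. u x * frechet_derivative \<phi> (at x) b + (g x \<bullet> b) * \<phi> x \<partial>lborel) = 0"
      using \<phi>0 by (intro integral_lipschitz_derivative_eq_0[OF _ S]) auto
    then have "(\<integral>x. u x * ?d x \<partial>lborel) = - (\<integral>x. (g x \<bullet> b) * \<phi> x \<partial>lborel)"
      using int1 int2 by (simp add: partial_derivative_def)
    then show ?thesis
      by (simp add: integral_completion)
  qed
  moreover have "locally_integrable u" "locally_integrable g"
    using M B by (auto intro!: locally_integrable_bounded)
  ultimately show ?thesis
    unfolding has_weak_gradient_def by blast
qed

text \<open>The norm is 1-Lipschitz and differentiable off the origin with gradient
  \<open>sgn x\<close>, so the chain rule applies outside a null set. The bounds on f and its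
  derivative are only asked for on the range of the norm.\<close>

lemma has_weak_gradient_radial:
  fixes f f' :: "real \<Rightarrow> real"
  assumes der: "\<And>r. r \<ge> 0 \<Longrightarrow> (f has_real_derivative f' r) (at r)"
    and M: "\<And>r. r \<ge> 0 \<Longrightarrow> \<bar>f r\<bar> \<le> M" and L: "\<And>r. r \<ge> 0 \<Longrightarrow> \<bar>f' r\<bar> \<le> L"
    and [measurable]: "f' \<in> borel_measurable borel"
  shows "has_weak_gradient (\<lambda>x::'a::euclidean_space. f (norm x)) (\<lambda>x. f' (norm x) *\<^sub>R sgn x)"
proof (rule has_weak_gradient_lipschitz)
  have L0: "L \<ge> 0" using L[of 0] by simp
  have "L-lipschitz_on {0..} f"
    using der L L0
    by (intro bounded_derivative_imp_lipschitz[where f' = "\<lambda>r h. f' r * h"] onorm_le)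
       (auto simp: has_field_derivative_def abs_mult intro: has_derivative_at_withinI mult_right_mono)
  then have lf: "L-lipschitz_on (range (norm :: 'a \<Rightarrow> real)) f"
    by (rule lipschitz_on_subset) auto
  have "1-lipschitz_on (UNIV :: 'a set) norm"
    by (rule lipschitz_onI) (auto simp: dist_norm norm_triangle_ineq3)
  from lipschitz_on_compose2[OF this lf]
  show "(L * 1)-lipschitz_on UNIV (\<lambda>x::'a. f (norm x))" .
  show "\<bar>f (norm x)\<bar> \<le> M" for x :: 'a using M by simp
  show "(\<lambda>x::'a. f' (norm x) *\<^sub>R sgn x) \<in> borel_measurable borel"
    unfolding sgn_div_norm by measurable
  show "norm (f' (norm x) *\<^sub>R sgn x) \<le> L" for x :: 'a
    using L[of "norm x"] L0 by (auto simp: norm_sgn)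
  have "AE x::'a in lborel. x \<noteq> 0"
    by (rule AE_lborel_singleton)
  then show "AE x::'a in lborel. ((\<lambda>x. f (norm x)) has_derivative (\<lambda>v. (f' (norm x) *\<^sub>R sgn x) \<bullet> v)) (at x)"
  proof eventually_elim
    case (elim x)
    have "(f has_derivative (\<lambda>h. f' (norm x) * h)) (at (norm x))"
      using der[of "norm x"] by (simp add: has_field_derivative_def)
    from has_derivative_compose[OF has_derivative_norm[OF elim] this]
    show ?case by (simp add: inner_commute)
  qed
qed

section \<open>Integrals of radial exponentials\<close>

text \<open>Writing \<open>exp (- p * norm x)\<close> as the integral of \<open>p * exp (- p * r)\<close> over \<open>r \<ge> norm x\<close> and applying
  Fubini reduces this to volumes of balls; no polar coordinates are needed.\<close>
lemma nn_integral_exp_norm: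
  fixes p :: real
  assumes p: "p > 0"
  shows "(\<integral>\<^sup>+(x::'a::euclidean_space). ennreal (exp (- p * norm x)) \<partial>lborel)
    = ennreal (unit_ball_vol (real DIM('a)) * fact DIM('a) / p ^ DIM('a))"
proof -
  let ?n = "DIM('a)"
  let ?V = "unit_ball_vol (real ?n)"
  let ?w = "\<lambda>r. p * exp (- p * r)"
  have tail: "(\<integral>\<^sup>+r. ennreal (?w r) * indicator {a..} r \<partial>lborel) = ennreal (exp (- p * a))" for a
  proof -
    have "((\<lambda>r. - exp (- p * r)) \<longlongrightarrow> 0) at_top"
      using p by real_asymp
    then have "(\<integral>\<^sup>+r. ennreal (?w r) * indicator {a..} r \<partial>lborel) = ennreal (0 - (- exp (- p * a)))"
      using p by (intro nn_integral_FTC_atLeast) (auto intro!: derivative_eq_intros)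
    then show ?thesis by simp
  qed
  \<comment> \<open>The ball of radius r contributes V r^n, and p exp(-p r) r^n is, up to the factor
    n!/p^n, the Erlang density of shape index n and rate p. For negative r both sides
    vanish.\<close>
  have slice: "(\<integral>\<^sup>+(x::'a). ennreal (?w r) * indicator {norm x..} r \<partial>lborel)
      = ennreal (?V * fact ?n / p ^ ?n) * ennreal (erlang_density ?n p r)" for r
  proof -
    have "(\<integral>\<^sup>+(x::'a). ennreal (?w r) * indicator {norm x..} r \<partial>lborel)
        = (\<integral>\<^sup>+(x::'a). ennreal (?w r) * indicator (cball 0 r) x \<partial>lborel)"
      by (intro nn_integral_cong) (auto simp: indicator_def)
    also have "\<dots> = ennreal (?w r) * emeasure lborel (cball (0::'a) r)"
      by (subst nn_integral_cmult_indicator) auto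
    also have "\<dots> = ennreal (?V * fact ?n / p ^ ?n) * ennreal (erlang_density ?n p r)"
    proof (cases "r \<ge> 0")
      case True
      then show ?thesis
        using p by (simp add: emeasure_cball erlang_density_def ennreal_mult'[symmetric] field_simps)
    qed (auto simp: erlang_density_def)
    finally show ?thesis .
  qed
  have "(\<integral>\<^sup>+(x::'a). ennreal (exp (- p * norm x)) \<partial>lborel)
      = (\<integral>\<^sup>+(x::'a). (\<integral>\<^sup>+r. ennreal (?w r) * indicator {norm x..} r \<partial>lborel) \<partial>lborel)"
    by (simp only: tail)
  also have "\<dots> = (\<integral>\<^sup>+r. (\<integral>\<^sup>+(x::'a). ennreal (?w r) * indicator {norm x..} r \<partial>lborel) \<partial>lborel)"
    by (rule lborel_pair.Fubini') (simp add: indicator_def)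
  also have "\<dots> = ennreal (?V * fact ?n / p ^ ?n) * (\<integral>\<^sup>+r. ennreal (erlang_density ?n p r) \<partial>lborel)"
    unfolding slice by (rule nn_integral_cmult) simp
  also have "\<dots> = ennreal (?V * fact ?n / p ^ ?n)"
    \<comment> \<open>The moment of order 0 is the total mass 1 of the density.\<close>
    using nn_integral_erlang_ith_moment[OF p, of ?n 0] by simp
  finally show ?thesis .
qed

section \<open>Reduction to an inequality between integrals\<close>

text \<open>A finite integral keeps \<open>epowr\<close> in its real branch, where the exponents 1/p
  and q multiply. Passing from \<open>lebesgue\<close> to \<open>lborel\<close> does not change the
  integral.\<close>

lemma epowr_Lp_norm:
  assumes "p > 0" and "(\<integral>\<^sup>+ x. ennreal (norm (f x) powr p) \<partial>lborel) = ennreal I" and "I \<ge> 0"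
  shows "epowr (Lp_norm p f) q = ennreal (I powr (q / p))"
  using assms by (simp add: Lp_norm_def epowr_def nn_integral_completion powr_powr)

text \<open>The cone over the unit sphere is the closed unit ball without its centre, so the surface
  area is the dimension times the volume of the ball.\<close>

lemma alpha_eq:
  "alpha TYPE('a::euclidean_space) = real DIM('a) *
    (real DIM('a) * unit_ball_vol (real DIM('a))) powr (1 / (real DIM('a) - 1))"
proof -
  have "{r *\<^sub>R x | r x. 0 < r \<and> r \<le> 1 \<and> x \<in> sphere (0::'a) 1} = cball 0 1 - {0}" (is "?A = ?B")
  proof
    show "?A \<subseteq> ?B" by auto
    have "\<exists>r y. x = r *\<^sub>R y \<and> 0 < r \<and> r \<le> 1 \<and> y \<in> sphere 0 1" if "x \<in> ?B" for x
      using that by (intro exI[of _ "norm x"] exI[of _ "sgn x"]) (auto simp: sgn_div_norm)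
    then show "?B \<subseteq> ?A" by blast
  qed
  moreover have "measure lebesgue (cball 0 1 - {0::'a}) = measure lebesgue (cball (0::'a) 1)"
    by (rule measure_negligible_symdiff) (auto intro: negligible_subset[of "{0}"])
  ultimately show ?thesis
    by (simp add: alpha_def unit_sphere_area_def sphere_measure_def content_cball)
qed

lemma B_GN_ge_quotient:
  fixes u :: "'a::euclidean_space \<Rightarrow> real" and g :: "'a \<Rightarrow> 'a"
  defines "N \<equiv> real DIM('a)"
  assumes N: "N > 1"
    and [measurable]: "u \<in> borel_measurable borel" "g \<in> borel_measurable borel"
    and wg: "has_weak_gradient u g"
    and I: "(\<integral>\<^sup>+ x. ennreal (norm (u x) powr (N * (N / (N - 1)))) \<partial>lborel) = ennreal I" "I > 0"
    and J: "(\<integral>\<^sup>+ x. ennreal (norm (u x) powr N) \<partial>lborel) = ennreal J" "J > 0"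
    and K: "(\<integral>\<^sup>+ x. ennreal (norm (g x) powr N) \<partial>lborel) = ennreal K" "K > 0"
  shows "ennreal (I / (J * K powr (1 / (N - 1)))) \<le> B_GN TYPE('a)"
proof -
  let ?p = "N * (N / (N - 1))"
  have p: "?p > 0" using N by simp
  have N0: "N > 0" using N by simp
  have fin: "Lp_norm N u < \<infinity>" "Lp_norm N g < \<infinity>"
    using J K by (simp_all add: Lp_norm_def epowr_def nn_integral_completion)
  have "u \<in> borel_measurable lebesgue" "g \<in> borel_measurable lebesgue"
    by (auto intro: measurable_completion)
  then have W: "u \<in> W1p N"
    using fin wg by (auto simp: W1p_def Lp_space_def)
  have nz: "\<not> (AE x in lebesgue. u x = 0)"
  proof
    assume "AE x in lebesgue. u x = 0"
    then have "(\<integral>\<^sup>+ x. ennreal (norm (u x) powr N) \<partial>lebesgue) = (\<integral>\<^sup>+ x. 0 \<partial>(lebesgue :: 'a measure))"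
      by (intro nn_integral_cong_AE) auto
    then show False using J by (simp add: nn_integral_completion)
  qed
  \<comment> \<open>Here N N' - N = N/(N-1), so the gradient factor becomes K to the power
    1/(N-1).\<close>
  have e: "(?p - N) / N = 1 / (N - 1)"
    using N by (simp add: field_simps)
  have "epowr (Lp_norm ?p u) ?p / (epowr (Lp_norm N u) N * epowr (Lp_norm N g) (?p - N))
      = ennreal (I / (J * K powr (1 / (N - 1))))"
    unfolding epowr_Lp_norm[OF p I(1) less_imp_le[OF I(2)]] epowr_Lp_norm[OF N0 J(1) less_imp_le[OF J(2)]]
      epowr_Lp_norm[OF N0 K(1) less_imp_le[OF K(2)]] e
    using I(2) J(2) K(2) N p by (simp add: ennreal_mult'[symmetric] divide_ennreal)
  then show ?thesis
    unfolding B_GN_def Let_def N_def[symmetric] using W nz wg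
    by (intro Sup_upper) (auto intro!: exI[of _ u] exI[of _ g])
qed

text \<open>The claim amounts to N < \<open>alpha\<close> times \<open>B_GN\<close>. The factor (N
  V)^(1/(N-1)) in \<open>alpha\<close>, with V the volume of the unit ball, is absorbed as a divisor
  of K. When I, J and K are all proportional to V, as for the exponentials below, V cancels from
  \<open>less\<close>.\<close>

lemma alpha_B_GN_criterion:
  fixes f f' :: "real \<Rightarrow> real"
  defines "N \<equiv> real DIM('a::euclidean_space)"
  assumes N: "N > 1"
    and [measurable]: "f \<in> borel_measurable borel" "f' \<in> borel_measurable borel"
    and der: "\<And>r. r \<ge> 0 \<Longrightarrow> (f has_real_derivative f' r) (at r)"
    and M: "\<And>r. r \<ge> 0 \<Longrightarrow> \<bar>f r\<bar> \<le> M" and L: "\<And>r. r \<ge> 0 \<Longrightarrow> \<bar>f' r\<bar> \<le> L"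
    and I: "(\<integral>\<^sup>+(x::'a). ennreal (\<bar>f (norm x)\<bar> powr (N * (N / (N - 1)))) \<partial>lborel) = ennreal I" "I > 0"
    and J: "(\<integral>\<^sup>+(x::'a). ennreal (\<bar>f (norm x)\<bar> powr N) \<partial>lborel) = ennreal J" "J > 0"
    and K: "(\<integral>\<^sup>+(x::'a). ennreal (\<bar>f' (norm x)\<bar> powr N) \<partial>lborel) = ennreal K" "K > 0"
    and less: "J * (K / (N * unit_ball_vol N)) powr (1 / (N - 1)) < I"
  shows "of_nat DIM('a) ^ 2 / (ennreal (alpha TYPE('a)) * B_GN TYPE('a)) < of_nat DIM('a)"
proof -
  let ?\<alpha> = "alpha TYPE('a)" and ?B = "B_GN TYPE('a)"
  let ?g = "\<lambda>x::'a. f' (norm x) *\<^sub>R sgn x"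
  define c where "c = I / (J * K powr (1 / (N - 1)))"
  have wg: "has_weak_gradient (\<lambda>x::'a. f (norm x)) ?g"
    using der M L by (intro has_weak_gradient_radial) auto
  have u_meas: "(\<lambda>x::'a. f (norm x)) \<in> borel_measurable borel"
    by measurable
  have g_meas: "?g \<in> borel_measurable borel"
    unfolding sgn_div_norm by measurable
  \<comment> \<open>Away from the origin \<open>sgn x\<close> is a unit vector, so the gradient has
    norm \<open>\<bar>f' (norm x)\<bar>\<close> almost everywhere.\<close>
  have "AE x::'a in lborel. x \<noteq> 0"
    by (rule AE_lborel_singleton)
  then have "AE x::'a in lborel. ennreal (norm (?g x) powr N) = ennreal (\<bar>f' (norm x)\<bar> powr N)"
    by eventually_elim (simp add: norm_sgn)
  then have K': "(\<integral>\<^sup>+ x. ennreal (norm (?g x) powr N) \<partial>lborel) = ennreal K"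
    using K(1) nn_integral_cong_AE by metis
  have cB: "ennreal c \<le> ?B"
    unfolding c_def
    by (rule B_GN_ge_quotient[where 'a = 'a, folded N_def, OF N u_meas g_meas wg
          I(1)[folded real_norm_def] I(2) J(1)[folded real_norm_def] J(2) K' K(2)])
  have V: "unit_ball_vol N > 0" using N by simp
  have NV: "N * unit_ball_vol N \<noteq> 0" using N V by (metis mult_pos_pos less_irrefl less_trans zero_less_one)
  have \<alpha>: "?\<alpha> = N * (N * unit_ball_vol N) powr (1 / (N - 1))"
    by (simp add: alpha_eq N_def)
  have \<alpha>0: "?\<alpha> > 0" unfolding \<alpha> using N NV by (intro mult_pos_pos) (linarith, simp only: powr_gt_zero not_False_eq_True)
  have c0: "c > 0" using I J K by (simp add: c_def)
  have "J * K powr (1 / (N - 1)) < I * (N * unit_ball_vol N) powr (1 / (N - 1))"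
    using less N V K by (simp add: powr_divide pos_divide_less_eq)
  then have "1 < (N * unit_ball_vol N) powr (1 / (N - 1)) * c"
    using J K by (simp add: c_def pos_less_divide_eq mult.commute)
  then have ac: "N < ?\<alpha> * c"
    using N by (simp add: \<alpha> mult.assoc)
  have ofN: "of_nat DIM('a) = ennreal N"
    by (simp add: N_def ennreal_of_nat_eq_real_of_nat)
  have acB: "ennreal (?\<alpha> * c) \<le> ennreal ?\<alpha> * ?B"
    using cB \<alpha>0 by (simp add: ennreal_mult' mult_left_mono)
  have nz: "ennreal ?\<alpha> * ?B \<noteq> 0"
    using acB \<alpha>0 c0 by (metis ennreal_eq_0_iff le_zero_eq mult_pos_pos not_less)
  show ?thesis
  proof (cases "ennreal ?\<alpha> * ?B < top")
    case True
    have "ennreal N ^ 2 = ennreal (N * N)"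
      using N by (simp add: power2_eq_square ennreal_mult'[symmetric])
    also have "\<dots> < ennreal (N * (?\<alpha> * c))"
      using ac N by (intro ennreal_lessI) auto
    also have "\<dots> \<le> ennreal N * (ennreal ?\<alpha> * ?B)"
      using acB N by (simp add: ennreal_mult' mult_left_mono)
    finally show ?thesis
      using True nz by (simp add: divide_less_ennreal ofN)
  next
    \<comment> \<open>If the product is infinite, the quotient is 0 in
      \<open>ennreal\<close>.\<close>
    case False
    then have "ennreal ?\<alpha> * ?B = top" by (metis top.not_eq_extremum)
    then show ?thesis using N by (simp add: ofN)
  qed
qed

section \<open>Dimension at least three\<close>

text \<open>With n = N - 1 this is the (N-1)-th power of the criterion for exp(-|x|). At n = 1 both
  sides equal 1/4, hence the start at 2.\<close>

lemma fact_less_power_ratio: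
  assumes "n \<ge> (2::nat)"
  shows "fact n / real (n + 1) ^ (n + 1) < ((real n / real (n + 1)) ^ (n + 1)) ^ n"
  using assms
proof (induction n rule: nat_induct_at_least)
  case base
  then show ?case by (simp add: power_divide)
next
  case (Suc n)
  define x where "x = real n"
  have x: "x \<ge> 2" using Suc by (simp add: x_def)
  \<comment> \<open>Bernoulli applies because the base is 1 + 1/(x (x + 2)), while the left side is
    1 + 1/(x + 1).\<close>
  have bern: "(x + 2) / (x + 1) \<le> ((x + 1)\<^sup>2 / (x * (x + 2))) ^ (n + 1)"
  proof -
    have "(x + 1) * (1 / (x * (x + 2))) - 1 / (x + 1) = 1 / (x * (x + 1) * (x + 2))"
      using x by (simp add: divide_simps) (simp add: algebra_simps)
    also have "\<dots> \<ge> 0" using x by simp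
    finally have "1 / (x + 1) \<le> real (n + 1) * (1 / (x * (x + 2)))"
      by (simp add: x_def add.commute)
    moreover have "(x + 2) / (x + 1) = 1 + 1 / (x + 1)"
      using x by (simp add: field_simps)
    ultimately have "(x + 2) / (x + 1) \<le> 1 + real (n + 1) * (1 / (x * (x + 2)))"
      by linarith
    also have "\<dots> \<le> (1 + 1 / (x * (x + 2))) ^ (n + 1)"
    proof (rule Bernoulli_inequality)
      have "0 \<le> 1 / (x * (x + 2))" using x by simp
      then show "- 1 \<le> 1 / (x * (x + 2))" by linarith
    qed
    also have "1 + 1 / (x * (x + 2)) = (x + 1)\<^sup>2 / (x * (x + 2))"
    proof -
      have "(x + 1)\<^sup>2 = x * (x + 2) + 1"
        by (simp add: power2_eq_square algebra_simps)
      moreover have "x * (x + 2) \<noteq> 0" using x by simp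
      ultimately show ?thesis by (simp only: add_divide_distrib divide_self) simp
    qed
    finally show ?thesis .
  qed
  let ?a = "x / (x + 1)" and ?b = "(x + 1) / (x + 2)"
  have b: "?b / ?a = (x + 1)\<^sup>2 / (x * (x + 2))"
    by (simp add: power2_eq_square mult.commute)
  \<comment> \<open>This is the growth condition of the induction: passing from n to n + 1
    multiplies the left side by \<open>?b ^ (n + 2)\<close>, and the right side by at least as much
    exactly when the n-th power of this quantity is at least 1.\<close>
  have step: "1 \<le> (?b / ?a) ^ (n + 1) * ?b"
  proof -
    have "1 = (x + 2) / (x + 1) * ?b" using x by simp
    also have "\<dots> \<le> (?b / ?a) ^ (n + 1) * ?b"
      unfolding b using bern x by (intro mult_right_mono) auto
    finally show ?thesis .
  qed
  have "fact (Suc n) / (x + 2) ^ (n + 2) = (x + 1) * fact n / (x + 2) ^ (n + 2)"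
    by (simp add: x_def algebra_simps)
  also have "\<dots> = fact n / (x + 1) ^ (n + 1) * ?b ^ (n + 2)"
    using x by (simp add: power_divide)
  also have "\<dots> < (?a ^ (n + 1)) ^ n * ?b ^ (n + 2)"
    using Suc.IH x by (intro mult_strict_right_mono) (simp_all add: x_def add.commute)
  \<comment> \<open>The inserted factor cancels every power of \<open>?a\<close> and leaves the
    exponent n(n+1) + (n+2) + n = (n+2)(n+1) on \<open>?b\<close>.\<close>
  also have "\<dots> \<le> (?a ^ (n + 1)) ^ n * ?b ^ (n + 2) * ((?b / ?a) ^ (n + 1) * ?b) ^ n"
    using mult_left_mono[OF one_le_power[OF step, of n], of "(?a ^ (n + 1)) ^ n * ?b ^ (n + 2)"] x by simp
  also have "\<dots> = ((?a * (?b / ?a)) ^ (n + 1)) ^ n * ?b ^ (n + 2) * ?b ^ n"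
    by (simp only: power_mult_distrib mult_ac)
  also have "?a * (?b / ?a) = ?b" using x by simp
  also have "(?b ^ (n + 1)) ^ n * ?b ^ (n + 2) * ?b ^ n = (?b ^ (n + 2)) ^ (n + 1)"
    by (simp only: power_add[symmetric] power_mult[symmetric]) (simp add: algebra_simps)
  finally show ?case
    by (simp add: x_def add_ac)
qed

text \<open>For f = exp(-r) the derivative is -f, so K = J, and the integral formula gives I/J =
  (N/q)^N = ((N-1)/N)^N with q = N N'.\<close>

lemma alpha_B_GN_less_high_dim:
  assumes dim: "DIM('a::euclidean_space) \<ge> 3"
  shows "of_nat DIM('a) ^ 2 / (ennreal (alpha TYPE('a)) * B_GN TYPE('a)) < of_nat DIM('a)"
proof -
  let ?N = "DIM('a)"
  let ?V = "unit_ball_vol (real ?N)"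
  define n where "n = ?N - 1"
  have n: "n \<ge> 2" "?N = n + 1" "real ?N - 1 = real n"
    using dim by (auto simp: n_def of_nat_diff)
  define q where "q = real ?N * (real ?N / (real ?N - 1))"
  have q: "q > 0" using n by (simp add: q_def)
  have V: "?V > 0" by simp
  have N0: "real ?N > 0" using n by simp
  note E = nn_integral_exp_norm[where 'a = 'a]
  have int: "(\<integral>\<^sup>+(x::'a). ennreal (\<bar>exp (- norm x)\<bar> powr p) \<partial>lborel) = ennreal (?V * fact ?N / p ^ ?N)"
    if "p > 0" for p
    using E[OF that] by (simp add: exp_powr_real mult.commute)
  let ?J = "?V * fact ?N / real ?N ^ ?N"
  have J0: "?J > 0"
    by (intro divide_pos_pos mult_pos_pos V zero_less_power N0) simp
  have nq: "real n / real ?N = real ?N / q"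
    unfolding q_def n(3) using N0 by simp
  have cancel: "v * (m * a) / c / (m * v) = a / c" if "v \<noteq> 0" "m \<noteq> 0" for v m a c :: real
    using that by simp
  have "fact ?N = real ?N * fact n" by (simp add: n(2))
  then have ratio: "?J / (real ?N * ?V) = fact n / real (n + 1) ^ (n + 1)"
    using cancel[of ?V "real ?N" "fact n" "real ?N ^ ?N"] V N0 by (simp only: n(2))
  have "(?J / (real ?N * ?V)) powr (1 / (real ?N - 1)) = (fact n / real (n + 1) ^ (n + 1)) powr (1 / real n)"
    by (simp only: n(3) ratio)
  also have "\<dots> < (((real n / real (n + 1)) ^ (n + 1)) ^ n) powr (1 / real n)"
    using fact_less_power_ratio[OF n(1)] n by (intro powr_less_mono2) auto
  also have "\<dots> = (real n / real (n + 1)) ^ (n + 1)"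
    using n by (simp add: powr_realpow[symmetric] powr_powr del: power_mult)
  finally have "?J * (?J / (real ?N * ?V)) powr (1 / (real ?N - 1)) < ?J * (real n / real (n + 1)) ^ (n + 1)"
    using J0 by (rule mult_strict_left_mono)
  also have "\<dots> = ?V * fact ?N / q ^ ?N"
    using N0 unfolding n(2)[symmetric] nq power_divide by simp
  finally have less: "?J * (?J / (real ?N * ?V)) powr (1 / (real ?N - 1)) < ?V * fact ?N / q ^ ?N" .
  show ?thesis
  proof (rule alpha_B_GN_criterion[where f = "\<lambda>r. exp (- r)" and f' = "\<lambda>r. - exp (- r)" and M = 1 and L = 1])
    show "?V * fact ?N / q ^ ?N > 0"
      by (intro divide_pos_pos mult_pos_pos V zero_less_power q) simp
    show "(\<integral>\<^sup>+(x::'a). ennreal (\<bar>exp (- norm x)\<bar> powr (real ?N * (real ?N / (real ?N - 1)))) \<partial>lborel)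
        = ennreal (?V * fact ?N / q ^ ?N)"
      using int[OF q] by (simp only: q_def)
    show "(\<integral>\<^sup>+(x::'a). ennreal (\<bar>exp (- norm x)\<bar> powr real ?N) \<partial>lborel) = ennreal ?J"
      "(\<integral>\<^sup>+(x::'a). ennreal (\<bar>- exp (- norm x)\<bar> powr real ?N) \<partial>lborel) = ennreal ?J"
      using int[OF N0] by (simp_all only: abs_minus_cancel)
    show "?J > 0" "?J > 0" by (fact J0)+
    show "?J * (?J / (real ?N * ?V)) powr (1 / (real ?N - 1)) < ?V * fact ?N / q ^ ?N"
      by (fact less)
  qed (use n in \<open>auto intro!: derivative_eq_intros\<close>)
qed

section \<open>Dimension two\<close>

text \<open>The profile is 1 - (1 - exp(-r))^2, with zero slope at the origin. Since N N' = 4 and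
  1/(N-1) = 1, only its second and fourth powers and the square of its derivative occur, all of them
  combinations of the exponentials \<open>E k\<close>.\<close>

lemma alpha_B_GN_less_dim_2:
  assumes dim: "DIM('a::euclidean_space) = 2"
  shows "of_nat DIM('a) ^ 2 / (ennreal (alpha TYPE('a)) * B_GN TYPE('a)) < of_nat DIM('a)"
proof -
  define f where "f r = 2 * exp (- r) - exp (- 2 * r)" for r :: real
  define f' where "f' r = 2 * exp (- 2 * r) - 2 * exp (- r)" for r :: real
  define V where "V = unit_ball_vol 2"
  define E where "E k = (\<lambda>x::'a. exp (- k * norm x))" for k
  have V: "V > 0" by (simp add: V_def)
  have E: "has_bochner_integral lborel (E k) (2 * V / k\<^sup>2)" if "k > 0" for k
  proof (rule has_bochner_integral_nn_integral)
    show "(\<integral>\<^sup>+ x. ennreal (E k x) \<partial>lborel) = ennreal (2 * V / k\<^sup>2)"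
      using nn_integral_exp_norm[where 'a = 'a, OF that]
      by (simp add: E_def V_def dim mult.commute)
  qed (use V in \<open>auto simp: E_def\<close>)
  \<comment> \<open>The expansions below have terms of both signs, so they are integrated as Bochner
    integrals; this returns to the nonnegative integrals of the criterion.\<close>
  have nn: "(\<integral>\<^sup>+ x. ennreal (h x) \<partial>lborel) = ennreal c"
    if "has_bochner_integral lborel h c" "\<And>x. 0 \<le> h x" for h :: "'a \<Rightarrow> real" and c
    using that by (simp add: has_bochner_integral_iff nn_integral_eq_integral)
  have fpos: "f r > 0" "f r \<le> 2" if "r \<ge> 0" for r
  proof -
    have "f r = exp (- r) * (2 - exp (- r))"
      by (simp add: f_def algebra_simps mult_exp_exp)
    moreover have "0 < exp (- r) * (2 - exp (- r))"
      using that by (intro mult_pos_pos) (simp_all add: le_less_trans[of _ 1])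
    ultimately show "f r > 0" by simp
    have "exp (- r) \<le> 1" using that by simp
    then show "f r \<le> 2"
      unfolding f_def using exp_gt_zero[of "- 2 * r"] by linarith
  qed
  have J: "has_bochner_integral lborel (\<lambda>x::'a. (f (norm x))\<^sup>2) (2 * V * (89 / 144))"
  proof -
    have "has_bochner_integral lborel (\<lambda>x. 4 * E 2 x - 4 * E 3 x + E 4 x)
        (4 * (2 * V / 2\<^sup>2) - 4 * (2 * V / 3\<^sup>2) + 2 * V / 4\<^sup>2)"
      by (intro has_bochner_integral_add has_bochner_integral_diff has_bochner_integral_mult_right E) auto
    moreover have "(f (norm x))\<^sup>2 = 4 * E 2 x - 4 * E 3 x + E 4 x" for x
      by (simp add: f_def E_def power2_eq_square algebra_simps mult_exp_exp)
    ultimately show ?thesis by simp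
  qed
  have K: "has_bochner_integral lborel (\<lambda>x::'a. (f' (norm x))\<^sup>2) (2 * V * (52 / 144))"
  proof -
    have "has_bochner_integral lborel (\<lambda>x. 4 * E 2 x - 8 * E 3 x + 4 * E 4 x)
        (4 * (2 * V / 2\<^sup>2) - 8 * (2 * V / 3\<^sup>2) + 4 * (2 * V / 4\<^sup>2))"
      by (intro has_bochner_integral_add has_bochner_integral_diff has_bochner_integral_mult_right E) auto
    moreover have "(f' (norm x))\<^sup>2 = 4 * E 2 x - 8 * E 3 x + 4 * E 4 x" for x
      by (simp add: f'_def E_def power2_eq_square algebra_simps mult_exp_exp)
    ultimately show ?thesis by simp
  qed
  \<comment> \<open>Dividing the fourth-power integral by 2 V leaves this number, about 0.239; the
    criterion asks that it exceed (89/144)(52/144), about 0.223.\<close>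
  define \<iota> :: real where "\<iota> = 1 - 32 / 25 + 2 / 3 - 8 / 49 + 1 / 64"
  have I: "has_bochner_integral lborel (\<lambda>x::'a. (f (norm x)) ^ 4) (2 * V * \<iota>)"
  proof -
    have "has_bochner_integral lborel (\<lambda>x. 16 * E 4 x - 32 * E 5 x + 24 * E 6 x - 8 * E 7 x + E 8 x)
        (16 * (2 * V / 4\<^sup>2) - 32 * (2 * V / 5\<^sup>2) + 24 * (2 * V / 6\<^sup>2) - 8 * (2 * V / 7\<^sup>2) + 2 * V / 8\<^sup>2)"
      by (intro has_bochner_integral_add has_bochner_integral_diff has_bochner_integral_mult_right E) auto
    moreover have "(f (norm x)) ^ 4 = 16 * E 4 x - 32 * E 5 x + 24 * E 6 x - 8 * E 7 x + E 8 x" for x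
      by (simp add: f_def E_def power4_eq_xxxx algebra_simps mult_exp_exp)
    moreover have "16 * (2 * V / 4\<^sup>2) - 32 * (2 * V / 5\<^sup>2) + 24 * (2 * V / 6\<^sup>2) - 8 * (2 * V / 7\<^sup>2)
        + 2 * V / 8\<^sup>2 = 2 * V * \<iota>"
      by (simp add: \<iota>_def algebra_simps)
    ultimately show ?thesis by (simp only:)
  qed
  show ?thesis
  proof (rule alpha_B_GN_criterion[where f = f and f' = f' and M = 2 and L = 4
        and I = "2 * V * \<iota>" and J = "2 * V * (89 / 144)" and K = "2 * V * (52 / 144)"])
    show "f \<in> borel_measurable borel" "f' \<in> borel_measurable borel"
      unfolding f_def f'_def by measurable
    show "(f has_real_derivative f' r) (at r)" for r
      unfolding f_def f'_def by (auto intro!: derivative_eq_intros)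
    show "\<bar>f' r\<bar> \<le> 4" if "r \<ge> 0" for r
    proof -
      have "0 < exp (- r)" "exp (- r) \<le> 1" "0 < exp (- 2 * r)" "exp (- 2 * r) \<le> 1" using that by auto
      then show ?thesis unfolding f'_def by linarith
    qed
    show "(\<integral>\<^sup>+(x::'a). ennreal (\<bar>f (norm x)\<bar> powr (real DIM('a) * (real DIM('a) / (real DIM('a) - 1)))) \<partial>lborel)
        = ennreal (2 * V * \<iota>)"
      using nn[OF I] by (simp add: dim powr_numeral)
    show "(\<integral>\<^sup>+(x::'a). ennreal (\<bar>f (norm x)\<bar> powr real DIM('a)) \<partial>lborel) = ennreal (2 * V * (89 / 144))"
      using nn[OF J] by (simp add: dim powr_numeral)
    show "(\<integral>\<^sup>+(x::'a). ennreal (\<bar>f' (norm x)\<bar> powr real DIM('a)) \<partial>lborel) = ennreal (2 * V * (52 / 144))"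
      using nn[OF K] by (simp add: dim powr_numeral)
    have "2 * V * (52 / 144) / (2 * V) = 52 / 144" using V by simp
    then show "2 * V * (89 / 144) * (2 * V * (52 / 144) / (real DIM('a) * unit_ball_vol (real DIM('a))))
        powr (1 / (real DIM('a) - 1)) < 2 * V * \<iota>"
      using V by (simp add: dim V_def[symmetric] \<iota>_def)
    show "\<bar>f r\<bar> \<le> 2" if "r \<ge> 0" for r using fpos[OF that] by simp
  qed (use V in \<open>simp_all add: dim \<iota>_def f_def f'_def\<close>)
qed

theorem mainTheorem3:
  fixes N :: nat
  assumes "N = CARD('n::finite)" and "N \<ge> 2"
  shows "of_nat N ^ 2 / (ennreal (alpha TYPE(real ^ 'n)) * B_GN TYPE(real ^ 'n)) < of_nat N"
proof (cases "N = 2")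
  case True
  then show ?thesis
    using alpha_B_GN_less_dim_2[where 'a = "real ^ 'n"] assms by simp
next
  case False
  then show ?thesis
    using alpha_B_GN_less_high_dim[where 'a = "real ^ 'n"] assms by simp
qed

end
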